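(* Let $x\in(0,1)$ be irrational with regular continued fraction expansion $x=[0;a_1,\ldots,a_t,\ldots]$, and suppose that all partial quotients satisfy $a_j\le 4$. Then $?'(x)=+\infty$ (that is, the derivative exists as an infinite limit).
   Context: The Minkowski question mark function $?:[0,1]\to[0,1]$ is defined as follows: $?(0)=0$, $?(1)=1$; if $?$ is already defined at successive Farey fractions $\frac pq<\frac{p'}{q'}$ (reduced fractions with $p'q-pq'=1$), then $?\left(\frac{p+p'}{q+q'}\right)=\frac12\left(?\left(\frac pq\right)+?\left(\frac{p'}{q'}\right)\right)$; at irrational $x$ it is defined by continuity. It is continuous and increasing, and for irrational $x=[0;a_1,a_2,\ldots]$ one has $?(x)=\sum_{n\ge1}\frac{(-1)^{n+1}}{2^{a_1+\cdots+a_n-1}}$. The notation $[0;a_1,a_2,\ldots]$ denotes the regular continued fraction $\cfrac{1}{a_1+\cfrac{1}{a_2+\cdots}}$ with partial quotients $a_i$ positive integers. The derivative $?'(x)=\lim_{\delta\to0}\frac{?(x+\delta)-?(x)}{\delta}$ is the two-sided limit, with the value $+\infty$ allowed. *)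

theory Defs
  imports Complex_Main
begin

text \<open>
  The graph of the question mark function on the rationals of \<open>[0, 1]\<close>:
  \<open>(p, q, u)\<close> means that \<open>p/q\<close> is a reduced fraction with \<open>?(p/q) = u\<close>.
\<close>

inductive_set qmark_graph :: "(nat \<times> nat \<times> real) set" where
  zero: "(0, 1, 0) \<in> qmark_graph"
| one: "(1, 1, 1) \<in> qmark_graph"
| mediant: "\<lbrakk>(p, q, u) \<in> qmark_graph; (p', q', u') \<in> qmark_graph; p' * q = p * q' + 1\<rbrakk>
    \<Longrightarrow> (p + p', q + q', (u + u') / 2) \<in> qmark_graph"

definition qmark_rat :: "real \<Rightarrow> real" where
  "qmark_rat r = (THE u. \<exists>p q. (p, q, u) \<in> qmark_graph \<and> r = real p / real q)"

text \<open>Only the values on \<open>[0, 1]\<close> are meaningful; elsewhere the function is unspecified.\<close>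

definition qmark :: "real \<Rightarrow> real" where
  "qmark x = (if x \<in> \<rat> then qmark_rat x else Lim (at x within \<rat> \<inter> {0..1}) qmark_rat)"

text \<open>\<open>cfrac_from a k n\<close> is \<open>[0; a\<^sub>k, \<dots>, a\<^sub>k\<^sub>+\<^sub>n\<^sub>-\<^sub>1]\<close>, with \<open>n\<close> partial quotients.\<close>

fun cfrac_from :: "(nat \<Rightarrow> nat) \<Rightarrow> nat \<Rightarrow> nat \<Rightarrow> real" where
  "cfrac_from a k 0 = 0"
| "cfrac_from a k (Suc n) = 1 / (real (a k) + cfrac_from a (Suc k) n)"

text \<open>\<open>x = [0; a\<^sub>1, a\<^sub>2, \<dots>]\<close>; the value \<open>a 0\<close> is not used.\<close>

definition has_cfrac :: "real \<Rightarrow> (nat \<Rightarrow> nat) \<Rightarrow> bool" where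
  "has_cfrac x a \<longleftrightarrow> (\<forall>j\<ge>1. a j \<ge> 1) \<and> (\<lambda>n. cfrac_from a 1 n) \<longlonglongrightarrow> x"

definition has_infinite_derivative :: "(real \<Rightarrow> real) \<Rightarrow> real \<Rightarrow> bool" where
  "has_infinite_derivative f x \<longleftrightarrow> filterlim (\<lambda>\<delta>. (f (x + \<delta>) - f x) / \<delta>) at_top (at 0)"

end

theory Submission
  imports Defs
begin

text \<open>
  Let \<open>p\<^sub>t / q\<^sub>t\<close> be the convergents of \<open>x\<close> and \<open>J\<^sub>t\<close> the interval between \<open>p\<^sub>t / q\<^sub>t\<close> and
  \<open>p\<^sub>t\<^sub>+\<^sub>1 / q\<^sub>t\<^sub>+\<^sub>1\<close>. These intervals shrink to \<open>x\<close>, so a point \<open>y \<noteq> x\<close> near \<open>x\<close> lies in \<open>J\<^sub>t\<close> but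
  not in \<open>J\<^sub>t\<^sub>+\<^sub>1\<close> for some large \<open>t\<close>. Then \<open>|y - x| \<le> 1 / (q\<^sub>t q\<^sub>t\<^sub>+\<^sub>1)\<close>, and the convergents of index
  \<open>t + 2\<close> and \<open>t + 4\<close> lie between \<open>y\<close> and \<open>x\<close>, so by monotonicity \<open>|?(y) - ?(x)|\<close> is at least a
  constant times \<open>2\<close> to the power \<open>-(a\<^sub>1 + \<dots> + a\<^sub>t\<^sub>+\<^sub>1)\<close>. It remains to see that
  \<open>q\<^sub>t q\<^sub>t\<^sub>+\<^sub>1\<close> outgrows \<open>2\<close> to the power \<open>a\<^sub>1 + \<dots> + a\<^sub>t\<^sub>+\<^sub>1\<close>: the form \<open>4 q\<^sub>t\<^sub>+\<^sub>1\<^sup>2 + 3 q\<^sub>t q\<^sub>t\<^sub>+\<^sub>1\<close> gains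
  a factor of at least \<open>1.01 \<cdot> 2\<^sup>a\<close> with every partial quotient \<open>a \<le> 4\<close>.
\<close>

section \<open>The graph of the question mark function\<close>

definition farey_pair :: "nat \<Rightarrow> nat \<Rightarrow> real \<Rightarrow> nat \<Rightarrow> nat \<Rightarrow> real \<Rightarrow> bool" where
  "farey_pair p q u p' q' u' \<longleftrightarrow>
     (p, q, u) \<in> qmark_graph \<and> (p', q', u') \<in> qmark_graph \<and> p' * q = p * q' + 1"

text \<open>The two implications at the end settle comparisons with the endpoints 0 and 1 in
  \<open>qmark_graph_mono\<close>.\<close>

lemma qmark_graph_bounds:
  "(p, q, u) \<in> qmark_graph \<Longrightarrow> 1 \<le> q \<and> p \<le> q \<and> 0 \<le> u \<and> u \<le> 1 \<and> (p = q \<longrightarrow> u = 1) \<and> (p = 0 \<longrightarrow> u = 0)"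
proof (induction p q u rule: qmark_graph.induct)
  case (mediant p q u p' q' u')
  have "p + p' \<noteq> q + q'"
  proof
    assume "p + p' = q + q'"
    then have "p = q" "p' = q'" using mediant by auto
    then show False using mediant(3) by (simp add: mult.commute)
  qed
  moreover have "p' \<noteq> 0" using mediant(3) by (intro notI) simp
  ultimately show ?case using mediant by auto
qed auto

lemma coprime_if_bezout:
  fixes P Q :: int
  assumes "P * b - a * Q = 1"
  shows "coprime P Q"
proof (rule coprimeI)
  fix k assume "k dvd P" "k dvd Q"
  then have "k dvd P * b - a * Q" by simp
  then show "is_unit k" using assms by simp
qed

text \<open>Each left parent has determinant 1 with the mediant P/Q, so its denominator is the
  inverse of P modulo Q; lying strictly between 0 and Q, it is determined.\<close>

lemma farey_parents_unique:
  fixes a b c d a' b' c' d' :: nat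
  assumes "c * b = a * d + 1" "c' * b' = a' * d' + 1"
    and "a + c = a' + c'" "b + d = b' + d'" "1 \<le> b" "1 \<le> d" "1 \<le> b'" "1 \<le> d'"
  shows "a = a' \<and> b = b' \<and> c = c' \<and> d = d'"
proof -
  define P Q where "P = int (a + c)" and "Q = int (b + d)"
  have c: "int c = P - int a" "int d = Q - int b" "int c' = P - int a'" "int d' = Q - int b'"
    using assms unfolding P_def Q_def by linarith+
  have 1: "int c * int b = int a * int d + 1" "int c' * int b' = int a' * int d' + 1"
    using assms(1,2) by (metis of_nat_1 of_nat_add of_nat_mult)+
  have e: "P * int b - int a * Q = 1" "P * int b' - int a' * Q = 1"
    using 1 unfolding c by (simp_all add: algebra_simps)
  have "P * (int b - int b') = Q * (int a - int a')"
    using e by (simp add: algebra_simps)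
  moreover have "coprime P Q" using e(1) by (rule coprime_if_bezout)
  ultimately have "Q dvd int b - int b'"
    by (metis coprime_commute coprime_dvd_mult_right_iff dvd_triv_left)
  moreover have "\<bar>int b - int b'\<bar> < Q" using assms unfolding Q_def by linarith
  ultimately have b: "b = b'"
    using zdvd_not_zless[of "\<bar>int b - int b'\<bar>" Q] by (cases "b = b'") auto
  have "Q > 0" using assms unfolding Q_def by simp
  then have "a = a'" using e b by (metis diff_add_cancel diff_left_imp_eq mult_right_cancel of_nat_eq_iff order_less_irrefl)
  then show ?thesis using b assms by simp
qed

text \<open>The determinant condition writes \<open>Q\<close> as \<open>q'\<close> times one
  positive integer plus \<open>q\<close> times another.\<close>

lemma farey_neighbours_separate:
  fixes p q p' q' P Q :: int
  assumes "p' * q - p * q' = 1" "0 < q" "0 < q'" "p * Q < P * q" "P * q' < p' * Q"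
  shows "q + q' \<le> Q"
proof -
  have "q' * (P * q - p * Q) + q * (p' * Q - P * q') = Q * (p' * q - p * q')"
    by (simp add: algebra_simps)
  moreover have "q' * 1 \<le> q' * (P * q - p * Q)" "q * 1 \<le> q * (p' * Q - P * q')"
    using assms by (intro mult_left_mono; simp)+
  ultimately show ?thesis using assms(1) by simp
qed

text \<open>
  The fraction with the larger denominator is the mediant of a pair of Farey neighbours of smaller
  denominator, and the other fraction cannot lie strictly between it and a neighbour; so that
  neighbour can be interposed.
\<close>

lemma qmark_graph_mono:
  assumes "(P, Q, u) \<in> qmark_graph" "(P', Q', u') \<in> qmark_graph" "P * Q' \<le> P' * Q"
  shows "u \<le> u'"
  using assms
proof (induction "Q + Q'" arbitrary: P Q u P' Q' u' rule: less_induct)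
  case less
  note b = qmark_graph_bounds[OF less.prems(1)] qmark_graph_bounds[OF less.prems(2)]
  \<comment> \<open>The denominators of the parents of one fraction add up to that fraction's
    denominator alone, so the induction hypothesis also orders the values of its two
    parents.\<close>
  have mu: "v \<le> v'" if "farey_pair p q v p' q' v'" "q + q' < Q + Q'" for p q v p' q' v'
    using less.hyps[of q q' p v p' v'] that unfolding farey_pair_def by simp
  show ?case using less.prems(1)
  proof (cases rule: qmark_graph.cases)
    case zero
    then show ?thesis using b by simp
  next
    case one
    then have "P' = Q'" using less.prems(3) b by simp
    then show ?thesis using b by simp
  next
    case (mediant A a v B b' w)
    note L = this
    have La: "1 \<le> a" "1 \<le> b'" using L qmark_graph_bounds by blast+
    show ?thesis using less.prems(2)
    proof (cases rule: qmark_graph.cases)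
      case zero
      then have "P = 0" using less.prems(3) b by simp
      then show ?thesis using b by simp
    next
      case one
      then show ?thesis using b by simp
    next
      case (mediant C c s D d t)
      note R = this
      have Ra: "1 \<le> c" "1 \<le> d" using R qmark_graph_bounds by blast+
      have vw: "v \<le> w" by (rule mu[of A a v B b' w]) (use L R Ra in \<open>auto simp: farey_pair_def\<close>)
      have st: "s \<le> t" by (rule mu[of C c s D d t]) (use L R La in \<open>auto simp: farey_pair_def\<close>)
      have Li: "int B * int a - int A * int b' = 1" "int D * int c - int C * int d = 1"
        using L(6) R(6)
        by (metis add_diff_cancel_left' of_nat_1 of_nat_add of_nat_mult)+
      consider (eq) "P * Q' = P' * Q" | (lt) "P * Q' < P' * Q" "Q' \<le> Q"
        | (gt) "P * Q' < P' * Q" "Q \<le> Q'" using less.prems(3) by linarith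
      then show ?thesis
      proof cases
        \<comment> \<open>Equal reduced fractions have the same denominator, hence the same parents;
          the induction hypothesis compares the values attached to these.\<close>
        case eq
        have "int P * int a - int A * int Q = 1" "int P' * int c - int C * int Q' = 1"
          using Li L R by (simp_all add: algebra_simps)
        then have cop: "coprime P Q" "coprime P' Q'"
          using coprime_if_bezout[of "int P" "int a" "int A" "int Q"]
            coprime_if_bezout[of "int P'" "int c" "int C" "int Q'"] by simp_all
        have "P = P' \<and> Q = Q'"
        proof -
          have "Q dvd Q'" "Q' dvd Q"
            using cop eq by (metis coprime_commute coprime_dvd_mult_right_iff dvd_triv_right)+
          then have "Q = Q'" by (rule dvd_antisym)
          then show ?thesis using eq b by simp
        qed
        then have "A = C \<and> a = c \<and> B = D \<and> b' = d"
          using farey_parents_unique[of B a A b' D c C d] L R La Ra by simp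
        then have "v \<le> s" "w \<le> t"
          using less.hyps[of a c A v C s] less.hyps[of b' d B w D t] L R La Ra by auto
        then show ?thesis using L R by simp
      next
        case lt
        have "B * Q' \<le> P' * b'"
        proof (rule ccontr)
          assume "\<not> ?thesis"
          then have "int P' * int b' < int B * int Q'" by (simp flip: of_nat_mult)
          moreover have "int P * int Q' < int P' * int Q" using lt by (simp flip: of_nat_mult)
          moreover have "int B * int Q - int P * int b' = 1" using L Li by (simp add: algebra_simps)
          ultimately have "int Q + int b' \<le> int Q'"
            using farey_neighbours_separate[of "int B" "int Q" "int P" "int b'" "int Q'" "int P'"] b La
            by simp
          then show False using lt La by simp
        qed
        then have "w \<le> u'" using less.hyps[of b' Q' B w P' u'] L La less.prems by simp
        then show ?thesis using L vw by simp
      next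
        case gt
        have "P * c \<le> C * Q"
        proof (rule ccontr)
          assume "\<not> ?thesis"
          then have "int C * int Q < int P * int c" by (simp flip: of_nat_mult)
          moreover have "int P * int Q' < int P' * int Q" using gt by (simp flip: of_nat_mult)
          moreover have "int P' * int c - int C * int Q' = 1" using R Li by (simp add: algebra_simps)
          ultimately have "int c + int Q' \<le> int Q"
            using farey_neighbours_separate[of "int P'" "int c" "int C" "int Q'" "int Q" "int P"] b Ra
            by simp
          then show False using gt Ra by simp
        qed
        then have "u \<le> s" using less.hyps[of Q c P u C s] R Ra less.prems by simp
        then show ?thesis using R st by simp
      qed
    qed
  qed
qed

lemma qmark_graph_mono_real:
  assumes "(p, q, u) \<in> qmark_graph" "(p', q', u') \<in> qmark_graph" "real p / real q \<le> real p' / real q'"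
  shows "u \<le> u'"
proof -
  have "real p * real q' \<le> real p' * real q"
    using assms qmark_graph_bounds[OF assms(1)] qmark_graph_bounds[OF assms(2)]
    by (simp add: field_simps)
  then have "p * q' \<le> p' * q" by (metis of_nat_le_iff of_nat_mult)
  then show ?thesis using qmark_graph_mono assms by blast
qed

text \<open>Monotonicity in both directions makes the graph single-valued, so the description in
  \<open>qmark_rat_def\<close> is proper.\<close>

lemma qmark_rat_eq:
  assumes "(p, q, u) \<in> qmark_graph"
  shows "qmark_rat (real p / real q) = u"
  unfolding qmark_rat_def
proof (rule the_equality)
  show "\<exists>p' q'. (p', q', u) \<in> qmark_graph \<and> real p / real q = real p' / real q'"
    using assms by blast
next
  fix v assume "\<exists>p' q'. (p', q', v) \<in> qmark_graph \<and> real p / real q = real p' / real q'"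
  then obtain p' q' where "(p', q', v) \<in> qmark_graph" "real p / real q = real p' / real q'" by blast
  then show "v = u"
    using qmark_graph_mono_real[OF assms, of p' q' v] qmark_graph_mono_real[of p' q' v p q u] assms
    by (intro antisym) auto
qed

section \<open>Farey intervals\<close>

lemma farey_pair_mediant:
  assumes "farey_pair p q u p' q' u'"
  shows "farey_pair p q u (p + p') (q + q') ((u + u') / 2)"
    and "farey_pair (p + p') (q + q') ((u + u') / 2) p' q' u'"
  using assms qmark_graph.mediant[of p q u p' q' u'] unfolding farey_pair_def
  by (auto simp: algebra_simps)

text \<open>A partial quotient acts on a Farey interval by repeated mediants with one end fixed,
  each halving the gap in value.\<close>

lemma farey_pair_keep_left:
  assumes "farey_pair p q u p' q' u'"
  shows "farey_pair p q u (j * p + p') (j * q + q') (u + (u' - u) / 2 ^ j)"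
proof (induction j)
  case (Suc j)
  have "(u + (u + (u' - u) / 2 ^ j)) / 2 = u + (u' - u) / 2 ^ Suc j" by (simp add: field_simps)
  moreover have "p + (j * p + p') = Suc j * p + p'" "q + (j * q + q') = Suc j * q + q'" by simp_all
  ultimately show ?case using farey_pair_mediant(1)[OF Suc] by metis
qed (use assms in simp)

lemma farey_pair_keep_right:
  assumes "farey_pair p q u p' q' u'"
  shows "farey_pair (j * p' + p) (j * q' + q) (u' + (u - u') / 2 ^ j) p' q' u'"
proof (induction j)
  case (Suc j)
  have "((u' + (u - u') / 2 ^ j) + u') / 2 = u' + (u - u') / 2 ^ Suc j" by (simp add: field_simps)
  moreover have "j * p' + p + p' = Suc j * p' + p" "j * q' + q + q' = Suc j * q' + q" by simp_all
  ultimately show ?case using farey_pair_mediant(2)[OF Suc] by metis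
qed (use assms in simp)

text \<open>Descent in the Stern-Brocot tree: \<open>y\<close> is never a mediant, so it falls
  strictly into one half. The gap in value serves the limit at irrationals; the growing denominators
  show that the graph reaches every rational.\<close>

lemma farey_pair_descent:
  fixes y :: real
  assumes "0 \<le> y" "y \<le> 1" and no: "\<not> (\<exists>p q u. (p, q, u) \<in> qmark_graph \<and> y = real p / real q)"
  shows "\<exists>p q u p' q' u'. farey_pair p q u p' q' u' \<and> real p / real q < y \<and> y < real p' / real q'
    \<and> u' - u = 1 / 2 ^ n \<and> n + 2 \<le> q + q'"
proof (induction n)
  case 0
  have "y \<noteq> real 0 / real 1" "y \<noteq> real 1 / real 1" using no qmark_graph.zero qmark_graph.one by blast+
  then show ?case using assms(1,2) qmark_graph.zero qmark_graph.one
    by (intro exI[of _ 0] exI[of _ 1] exI[of _ "0::real"] exI[of _ "1::real"]) (auto simp: farey_pair_def)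
next
  case (Suc n)
  then obtain p q u p' q' u' where f: "farey_pair p q u p' q' u'" "real p / real q < y"
    "y < real p' / real q'" "u' - u = 1 / 2 ^ n" "n + 2 \<le> q + q'" by blast
  let ?m = "real (p + p') / real (q + q')"
  have q: "1 \<le> q" "1 \<le> q'" using f(1) qmark_graph_bounds unfolding farey_pair_def by blast+
  have "y \<noteq> ?m"
    using no farey_pair_mediant(1)[OF f(1)] unfolding farey_pair_def by blast
  then consider "y < ?m" | "?m < y" by linarith
  then show ?case
  proof cases
    case 1
    have "farey_pair p q u (p + p') (q + q') ((u + u') / 2) \<and> real p / real q < y \<and> y < ?m
      \<and> (u + u') / 2 - u = 1 / 2 ^ Suc n \<and> Suc n + 2 \<le> q + (q + q')"
      using farey_pair_mediant(1)[OF f(1)] f 1 q by (auto simp: field_simps)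
    then show ?thesis by blast
  next
    case 2
    have "farey_pair (p + p') (q + q') ((u + u') / 2) p' q' u' \<and> ?m < y \<and> y < real p' / real q'
      \<and> u' - (u + u') / 2 = 1 / 2 ^ Suc n \<and> Suc n + 2 \<le> (q + q') + q'"
      using farey_pair_mediant(2)[OF f(1)] f 2 q by (auto simp: field_simps)
    then show ?thesis by blast
  qed
qed

text \<open>A fraction with denominator \<open>Q\<close> missed by the graph would lie between Farey
  neighbours whose denominators add up to more than \<open>Q\<close>, against
  \<open>farey_neighbours_separate\<close>.\<close>

lemma rational_in_qmark_graph:
  fixes y :: real
  assumes "y \<in> \<rat>" "0 \<le> y" "y \<le> 1"
  shows "\<exists>p q u. (p, q, u) \<in> qmark_graph \<and> y = real p / real q"
proof (rule ccontr)
  assume no: "\<not> ?thesis"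
  obtain P Q where PQ: "y = of_int P / of_int Q" "0 < Q"
    using assms(1) by (metis Rats_cases')
  obtain p q u p' q' u' where f: "farey_pair p q u p' q' u'" "real p / real q < y"
    "y < real p' / real q'" "nat Q + 2 \<le> q + q'"
    using farey_pair_descent[OF assms(2,3) no, of "nat Q"] by blast
  have q: "1 \<le> q" "1 \<le> q'" using f(1) qmark_graph_bounds unfolding farey_pair_def by blast+
  have "real p * of_int Q < of_int P * real q" "of_int P * real q' < real p' * of_int Q"
    using f(2,3) PQ q by (simp_all add: field_simps)
  then have "int p * Q < P * int q" "P * int q' < int p' * Q"
    by (metis of_int_less_iff of_int_mult of_int_of_nat_eq)+
  moreover have "int p' * int q - int p * int q' = 1"
    using f(1) unfolding farey_pair_def by (metis add_diff_cancel_left' of_nat_1 of_nat_add of_nat_mult)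
  ultimately have "int q + int q' \<le> Q"
    using farey_neighbours_separate[of "int p'" "int q" "int p" "int q'" Q P] q by simp
  then show False using f(4) by linarith
qed

section \<open>Monotonicity of the question mark function\<close>

lemma qmark_rat_mono:
  assumes "r \<in> \<rat> \<inter> {0..1}" "s \<in> \<rat> \<inter> {0..1}" "r \<le> s"
  shows "qmark_rat r \<le> qmark_rat s"
proof -
  obtain p q u p' q' u' where "(p, q, u) \<in> qmark_graph" "r = real p / real q"
    "(p', q', u') \<in> qmark_graph" "s = real p' / real q'"
    using rational_in_qmark_graph[of r] rational_in_qmark_graph[of s] assms by auto
  then show ?thesis using qmark_graph_mono_real[of p q u p' q' u'] assms(3) by (simp add: qmark_rat_eq)
qed

lemma qmark_graph_point:
  assumes "(p, q, u) \<in> qmark_graph"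
  shows "real p / real q \<in> \<rat> \<inter> {0..1}" "qmark (real p / real q) = u"
  using qmark_graph_bounds[OF assms] qmark_rat_eq[OF assms] by (auto simp: qmark_def)

text \<open>A limit identifies the value of \<open>Lim\<close> only along a nontrivial
  filter.\<close>

lemma at_within_Rats_neq_bot:
  fixes y :: real
  assumes "0 < y" "y < 1"
  shows "at y within \<rat> \<inter> {0..1} \<noteq> bot"
proof -
  have "\<exists>r\<in>\<rat> \<inter> {0..1}. r \<noteq> y \<and> dist r y < e" if "0 < e" for e
  proof -
    obtain r where "r \<in> \<rat>" "y < r" "r < min 1 (y + e)"
      using Rats_dense_in_real[of y "min 1 (y + e)"] assms \<open>0 < e\<close> by auto
    then show ?thesis using assms by (intro bexI[of _ r]) (auto simp: dist_real_def)
  qed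
  then show ?thesis unfolding trivial_limit_def eventually_at by blast
qed

text \<open>The limit in \<open>qmark_def\<close> must first be shown to exist. The candidate is the
  supremum of the values to the left; it and the values at all nearby rationals are trapped in the
  value gap of a Farey interval around \<open>y\<close>.\<close>

lemma qmark_irrational_bounds:
  fixes y :: real
  assumes "y \<notin> \<rat>" "0 < y" "y < 1" and r: "r \<in> \<rat> \<inter> {0..1}"
  shows "(r < y \<longrightarrow> qmark_rat r \<le> qmark y) \<and> (y < r \<longrightarrow> qmark y \<le> qmark_rat r)"
proof -
  let ?A = "{r \<in> \<rat> \<inter> {0..1}. r < y}"
  define L where "L = Sup (qmark_rat ` ?A)"
  have ub: "qmark_rat s \<le> qmark_rat r" if "s \<in> ?A" "r \<in> \<rat> \<inter> {0..1}" "y < r" for s r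
    using qmark_rat_mono that by auto
  have bdd: "bdd_above (qmark_rat ` ?A)"
    using ub[of _ 1] assms by (intro bdd_aboveI2[of _ _ "qmark_rat 1"]) auto
  have low: "qmark_rat r \<le> L" if "r \<in> ?A" for r
    unfolding L_def by (rule cSUP_upper[OF that bdd])
  have up: "L \<le> qmark_rat r" if "r \<in> \<rat> \<inter> {0..1}" "y < r" for r
    unfolding L_def by (rule cSUP_least) (use ub that assms in \<open>auto intro!: exI[of _ 0]\<close>)
  have "(qmark_rat \<longlongrightarrow> L) (at y within \<rat> \<inter> {0..1})"
  proof (rule tendstoI)
    fix e :: real assume "0 < e"
    then obtain n where n: "(1 / 2) ^ n < e" using real_arch_pow_inv[of e "1/2"] by auto
    have "\<not> (\<exists>p q u. (p, q, u) \<in> qmark_graph \<and> y = real p / real q)"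
      using assms(1) by auto
    then obtain p q u p' q' u' where f: "farey_pair p q u p' q' u'" "real p / real q < y"
      "y < real p' / real q'" "u' - u = 1 / 2 ^ n"
      using farey_pair_descent[of y n] assms by auto
    have g: "(p, q, u) \<in> qmark_graph" "(p', q', u') \<in> qmark_graph"
      using f(1) unfolding farey_pair_def by auto
    have L: "u \<le> L" "L \<le> u'"
      using low[of "real p / real q"] up[of "real p' / real q'"] f(2,3)
        qmark_graph_point(1)[OF g(1)] qmark_graph_point(1)[OF g(2)] g by (auto simp: qmark_rat_eq)
    have "eventually (\<lambda>r. r \<in> {real p / real q<..<real p' / real q'}) (at y within \<rat> \<inter> {0..1})"
      using f(2,3) by (intro eventually_at_in_open' filter_leD[OF at_le[OF subset_UNIV]]) auto
    moreover have "eventually (\<lambda>r. r \<in> \<rat> \<inter> {0..1}) (at y within \<rat> \<inter> {0..1})"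
      by (simp add: eventually_at_filter)
    ultimately show "eventually (\<lambda>r. dist (qmark_rat r) L < e) (at y within \<rat> \<inter> {0..1})"
    proof eventually_elim
      case (elim r)
      have "u \<le> qmark_rat r" "qmark_rat r \<le> u'"
        using qmark_rat_mono[of "real p / real q" r] qmark_rat_mono[of r "real p' / real q'"] elim
          qmark_graph_point(1)[OF g(1)] qmark_graph_point(1)[OF g(2)] g by (auto simp: qmark_rat_eq)
      then have "\<bar>qmark_rat r - L\<bar> \<le> u' - u" using L by (simp add: abs_le_iff)
      then show ?case using n f(4) by (simp add: dist_real_def power_one_over)
    qed
  qed
  then have "qmark y = L"
    using tendsto_Lim[OF at_within_Rats_neq_bot[OF assms(2,3)]] assms(1) by (simp add: qmark_def)
  then show ?thesis using low up r by auto
qed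

lemma qmark_mono:
  assumes "0 \<le> y" "y \<le> z" "z \<le> 1"
  shows "qmark y \<le> qmark z"
proof (cases "y = z")
  case False
  \<comment> \<open>An intermediate rational reduces all cases to comparing \<open>y\<close> and
    \<open>z\<close> with a rational.\<close>
  obtain r where r: "r \<in> \<rat>" "y < r" "r < z" using Rats_dense_in_real[of y z] False assms by auto
  then have rI: "r \<in> \<rat> \<inter> {0..1}" using assms by auto
  have "qmark y \<le> qmark_rat r"
  proof (cases "y \<in> \<rat>")
    case True
    then show ?thesis using qmark_rat_mono[of y r] rI r assms by (simp add: qmark_def)
  next
    case irr: False
    then have "y \<noteq> 0" by auto
    then show ?thesis using qmark_irrational_bounds[OF irr _ _ rI] r assms by simp
  qed
  moreover have "qmark_rat r \<le> qmark z"
  proof (cases "z \<in> \<rat>")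
    case True
    then show ?thesis using qmark_rat_mono[of r z] rI r assms by (simp add: qmark_def)
  next
    case irr: False
    then have "z \<noteq> 1" by auto
    then show ?thesis using qmark_irrational_bounds[OF irr _ _ rI] r assms by simp
  qed
  ultimately show ?thesis by simp
qed simp

text \<open>The increment over the inner interval from \<open>c\<close> to \<open>c'\<close> is at
  most that over the outer one from \<open>y\<close> to \<open>x\<close>; the disjuncts put
  \<open>y\<close> to the left or to the right of \<open>x\<close>.\<close>

lemma qmark_slope_ge:
  assumes "(0 \<le> y \<and> y \<le> c \<and> c \<le> c' \<and> c' \<le> x \<and> x \<le> 1) \<or> (0 \<le> x \<and> x \<le> c' \<and> c' \<le> c \<and> c \<le> y \<and> y \<le> 1)"
  shows "\<bar>qmark c' - qmark c\<bar> / \<bar>y - x\<bar> \<le> (qmark y - qmark x) / (y - x)"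
  using assms
proof
  assume a: "0 \<le> y \<and> y \<le> c \<and> c \<le> c' \<and> c' \<le> x \<and> x \<le> 1"
  then have "qmark y \<le> qmark c" "qmark c \<le> qmark c'" "qmark c' \<le> qmark x"
    by (auto intro: qmark_mono)
  moreover have "(qmark y - qmark x) / (y - x) = (qmark x - qmark y) / \<bar>y - x\<bar>"
    using a by (metis abs_minus_commute abs_of_nonneg diff_ge_0_iff_ge minus_diff_eq minus_divide_divide order_trans)
  ultimately show ?thesis by (auto intro!: divide_right_mono)
next
  assume a: "0 \<le> x \<and> x \<le> c' \<and> c' \<le> c \<and> c \<le> y \<and> y \<le> 1"
  then have "qmark c \<le> qmark y" "qmark c' \<le> qmark c" "qmark x \<le> qmark c'"
    by (auto intro: qmark_mono)
  moreover have "\<bar>y - x\<bar> = y - x" using a by linarith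
  ultimately show ?thesis by (auto intro!: divide_right_mono)
qed

section \<open>Convergents\<close>

text \<open>The recursion starts from 0/1 and 1/a_1, which avoids the formal convergent 1/0 of index
  -1.\<close>

fun conv_num :: "(nat \<Rightarrow> nat) \<Rightarrow> nat \<Rightarrow> nat" where
  "conv_num a 0 = 0"
| "conv_num a (Suc 0) = 1"
| "conv_num a (Suc (Suc k)) = a (Suc (Suc k)) * conv_num a (Suc k) + conv_num a k"

fun conv_den :: "(nat \<Rightarrow> nat) \<Rightarrow> nat \<Rightarrow> nat" where
  "conv_den a 0 = 1"
| "conv_den a (Suc 0) = a 1"
| "conv_den a (Suc (Suc k)) = a (Suc (Suc k)) * conv_den a (Suc k) + conv_den a k"

text \<open>
  Passing to the next convergent means taking \<open>a\<^sub>k\<^sub>+\<^sub>2\<close> successive mediants with the \<open>(k + 1)\<close>-st one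
  fixed, and each mediant halves the increment of the question mark function.
\<close>

fun conv_qmark :: "(nat \<Rightarrow> nat) \<Rightarrow> nat \<Rightarrow> real" where
  "conv_qmark a 0 = 0"
| "conv_qmark a (Suc 0) = 2 / 2 ^ a 1"
| "conv_qmark a (Suc (Suc k)) =
     conv_qmark a (Suc k) + (conv_qmark a k - conv_qmark a (Suc k)) / 2 ^ a (Suc (Suc k))"

definition convergent_of :: "(nat \<Rightarrow> nat) \<Rightarrow> nat \<Rightarrow> real" where
  "convergent_of a k = real (conv_num a k) / real (conv_den a k)"

text \<open>Convergents of even index are the left ends. Each step keeps the newer convergent and
  moves the older one by the next partial quotient's number of mediants.\<close>

lemma convergents_farey_pair:
  assumes "1 \<le> a 1"
  shows "if even k
    then farey_pair (conv_num a k) (conv_den a k) (conv_qmark a k)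
      (conv_num a (Suc k)) (conv_den a (Suc k)) (conv_qmark a (Suc k))
    else farey_pair (conv_num a (Suc k)) (conv_den a (Suc k)) (conv_qmark a (Suc k))
      (conv_num a k) (conv_den a k) (conv_qmark a k)"
proof (induction k)
  case 0
  \<comment> \<open>Since 1/1 already is 1/a_1 for a_1 = 1, only \<open>a 1 - 1\<close> mediants
    lead to 1/a_1; hence the numerator 2 in \<open>conv_qmark a (Suc 0)\<close>.\<close>
  have "farey_pair 0 1 0 1 1 1"
    using qmark_graph.zero qmark_graph.one by (simp add: farey_pair_def)
  from farey_pair_keep_left[OF this, of "a 1 - 1"]
  have "farey_pair 0 1 0 1 (a 1) (1 / 2 ^ (a 1 - 1))" using assms by simp
  moreover have "(1::real) / 2 ^ (a 1 - 1) = 2 / 2 ^ a 1"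
    using assms by (simp add: power_diff)
  ultimately show ?case by simp
next
  case (Suc k)
  show ?case
  proof (cases "even k")
    case True
    then show ?thesis using Suc farey_pair_keep_right by simp
  next
    case False
    then show ?thesis using Suc farey_pair_keep_left by simp
  qed
qed

lemma convergents_in_graph:
  assumes "1 \<le> a 1"
  shows "(conv_num a k, conv_den a k, conv_qmark a k) \<in> qmark_graph"
  using convergents_farey_pair[of a k, OF assms] by (auto simp: farey_pair_def split: if_splits)

lemma convergent_of_point:
  assumes "1 \<le> a 1"
  shows "convergent_of a k \<in> {0..1}" "qmark (convergent_of a k) = conv_qmark a k"
  using qmark_graph_point[OF convergents_in_graph[of a k, OF assms]] by (simp_all add: convergent_of_def)

lemma conv_den_pos:
  assumes "1 \<le> a 1"
  shows "0 < conv_den a k"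
  using qmark_graph_bounds[OF convergents_in_graph[of a k, OF assms]] by simp

lemma convergent_of_diff:
  assumes "1 \<le> a 1"
  shows "\<bar>convergent_of a (Suc k) - convergent_of a k\<bar> = 1 / (real (conv_den a k) * real (conv_den a (Suc k)))"
proof -
  let ?p = "\<lambda>k. real (conv_num a k)" and ?q = "\<lambda>k. real (conv_den a k)"
  have "\<bar>?p (Suc k) * ?q k - ?p k * ?q (Suc k)\<bar> = 1"
  proof (cases "even k")
    case True
    then have "conv_num a (Suc k) * conv_den a k = conv_num a k * conv_den a (Suc k) + 1"
      using convergents_farey_pair[of a k, OF assms] by (simp add: farey_pair_def)
    then have "?p (Suc k) * ?q k = ?p k * ?q (Suc k) + 1" by (metis of_nat_1 of_nat_add of_nat_mult)
    then show ?thesis by simp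
  next
    case False
    then have "conv_num a k * conv_den a (Suc k) = conv_num a (Suc k) * conv_den a k + 1"
      using convergents_farey_pair[of a k, OF assms] by (simp add: farey_pair_def)
    then have "?p k * ?q (Suc k) = ?p (Suc k) * ?q k + 1" by (metis of_nat_1 of_nat_add of_nat_mult)
    then show ?thesis by simp
  qed
  moreover have "convergent_of a (Suc k) - convergent_of a k
      = (?p (Suc k) * ?q k - ?p k * ?q (Suc k)) / (?q k * ?q (Suc k))"
    using conv_den_pos[of a k, OF assms] conv_den_pos[of a "Suc k", OF assms]
    by (simp add: convergent_of_def field_simps)
  ultimately show ?thesis by (simp add: abs_divide abs_mult)
qed

lemma conv_qmark_diff:
  "\<bar>conv_qmark a (Suc k) - conv_qmark a k\<bar> = 2 / 2 ^ (\<Sum>i=1..Suc k. a i)"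
proof (induction k)
  case (Suc k)
  have "\<bar>conv_qmark a (Suc (Suc k)) - conv_qmark a (Suc k)\<bar>
      = \<bar>conv_qmark a (Suc k) - conv_qmark a k\<bar> / 2 ^ a (Suc (Suc k))"
    by (simp add: abs_divide abs_minus_commute)
  then show ?case by (simp add: Suc.IH power_add)
qed simp

text \<open>In value, two steps cover the fraction 1 - 2^(-a_(k+2)), at least half, of the gap
  between consecutive convergents.\<close>

lemma conv_qmark_diff2_ge:
  assumes "1 \<le> a (Suc (Suc k))"
  shows "1 / 2 ^ (\<Sum>i=1..Suc k. a i) \<le> \<bar>conv_qmark a (Suc (Suc k)) - conv_qmark a k\<bar>"
proof -
  let ?d = "conv_qmark a (Suc k) - conv_qmark a k" and ?e = "1 - 1 / 2 ^ a (Suc (Suc k)) :: real"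
  have "(2::real) ^ 1 \<le> 2 ^ a (Suc (Suc k))" using assms by (intro power_increasing) auto
  then have e: "1 / 2 \<le> ?e" by (simp add: field_simps)
  have "conv_qmark a (Suc (Suc k)) - conv_qmark a k = ?d * ?e" by (simp add: field_simps)
  then have "\<bar>conv_qmark a (Suc (Suc k)) - conv_qmark a k\<bar> = \<bar>?d\<bar> * ?e"
    using e by (simp add: abs_mult)
  also have "\<dots> \<ge> \<bar>?d\<bar> * (1 / 2)" using e by (intro mult_left_mono) auto
  finally show ?thesis unfolding conv_qmark_diff by simp
qed

text \<open>After cross-multiplication, the difference for indices k and k + 2 is a_(k+2) times that
  for k and k + 1.\<close>

lemma convergent_of_step2:
  assumes "1 \<le> a 1"
  shows "if even k then convergent_of a k \<le> convergent_of a (Suc (Suc k))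
    else convergent_of a (Suc (Suc k)) \<le> convergent_of a k"
proof -
  let ?p = "conv_num a" and ?q = "conv_den a"
  have pos: "0 < ?q k" "0 < ?q (Suc (Suc k))" using conv_den_pos[of a, OF assms] by blast+
  have "if even k then ?p k * ?q (Suc k) \<le> ?p (Suc k) * ?q k else ?p (Suc k) * ?q k \<le> ?p k * ?q (Suc k)"
    using convergents_farey_pair[of a k, OF assms] by (simp add: farey_pair_def split: if_splits)
  then have "if even k then a (Suc (Suc k)) * (?p k * ?q (Suc k)) \<le> a (Suc (Suc k)) * (?p (Suc k) * ?q k)
    else a (Suc (Suc k)) * (?p (Suc k) * ?q k) \<le> a (Suc (Suc k)) * (?p k * ?q (Suc k))"
    by (auto split: if_splits)
  then have "if even k then ?p k * ?q (Suc (Suc k)) \<le> ?p (Suc (Suc k)) * ?q k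
    else ?p (Suc (Suc k)) * ?q k \<le> ?p k * ?q (Suc (Suc k))"
    by (simp add: algebra_simps split: if_splits)
  then have "if even k then real (?p k) * real (?q (Suc (Suc k))) \<le> real (?p (Suc (Suc k))) * real (?q k)
    else real (?p (Suc (Suc k))) * real (?q k) \<le> real (?p k) * real (?q (Suc (Suc k)))"
    by (metis of_nat_le_iff of_nat_mult)
  then show ?thesis using pos by (simp add: convergent_of_def field_simps del: conv_num.simps conv_den.simps split: if_splits)
qed

text \<open>For x = [0; a_1, a_2, ...] this is the remainder [0; a_(k+1), a_(k+2), ...].\<close>

fun cfrac_tail :: "(nat \<Rightarrow> nat) \<Rightarrow> real \<Rightarrow> nat \<Rightarrow> real" where
  "cfrac_tail a x 0 = x"
| "cfrac_tail a x (Suc k) = 1 / cfrac_tail a x k - real (a (Suc k))"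

lemma cfrac_from_nonneg: "0 \<le> cfrac_from a k n"
  by (induction a k n rule: cfrac_from.induct) auto

lemma cfrac_tail_pos:
  assumes "has_cfrac x a" "x \<notin> \<rat>"
  shows "0 < cfrac_tail a x k"
proof -
  \<comment> \<open>The limit gives nonnegativity and irrationality excludes 0; both are carried
    along, as the next remainder is a limit of reciprocals.\<close>
  have "cfrac_from a (Suc k) \<longlonglongrightarrow> cfrac_tail a x k \<and> cfrac_tail a x k \<notin> \<rat> \<and> 0 < cfrac_tail a x k"
  proof (induction k)
    case 0
    have lim: "cfrac_from a 1 \<longlonglongrightarrow> x" using assms(1) by (simp add: has_cfrac_def)
    then have "0 \<le> x" by (rule LIMSEQ_le_const) (auto intro: cfrac_from_nonneg)
    moreover have "x \<noteq> 0" using assms(2) by auto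
    ultimately show ?case using lim assms(2) by simp
  next
    case (Suc k)
    let ?y = "cfrac_tail a x k"
    have "(\<lambda>n. 1 / cfrac_from a (Suc k) (Suc n) - real (a (Suc k))) \<longlonglongrightarrow> 1 / ?y - real (a (Suc k))"
      using Suc by (intro tendsto_intros LIMSEQ_Suc) auto
    then have lim: "cfrac_from a (Suc (Suc k)) \<longlonglongrightarrow> cfrac_tail a x (Suc k)" by simp
    then have "0 \<le> cfrac_tail a x (Suc k)" by (rule LIMSEQ_le_const) (auto intro: cfrac_from_nonneg)
    moreover have irr: "cfrac_tail a x (Suc k) \<notin> \<rat>"
    proof
      assume "cfrac_tail a x (Suc k) \<in> \<rat>"
      then have "1 / (cfrac_tail a x (Suc k) + real (a (Suc k))) \<in> \<rat>"
        by (intro Rats_divide Rats_add) auto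
      then show False using Suc by simp
    qed
    then have "cfrac_tail a x (Suc k) \<noteq> 0" by (metis Rats_0)
    ultimately show ?case using lim irr by simp
  qed
  then show ?thesis by simp
qed

text \<open>The error x q_k - p_k starts at x > 0 and is multiplied at each step by the negative of
  a positive remainder, so its sign alternates.\<close>

lemma convergent_of_alternates:
  assumes "has_cfrac x a" "x \<notin> \<rat>"
  shows "if even k then convergent_of a k < x else x < convergent_of a k"
proof -
  let ?y = "cfrac_tail a x"
  define d where "d k = x * real (conv_den a k) - real (conv_num a k)" for k
  have a1: "1 \<le> a 1" using assms(1) by (simp add: has_cfrac_def)
  note y = cfrac_tail_pos[OF assms]
  have d: "d (Suc k) = - ?y (Suc k) * d k" for k
  proof (induction k)
    case 0
    then show ?case using y[of 0] by (simp add: d_def field_simps)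
  next
    case (Suc k)
    have "?y (Suc k) * (?y (Suc (Suc k)) + real (a (Suc (Suc k)))) = 1"
      using y[of "Suc k"] by (simp del: cfrac_tail.simps(2) add: cfrac_tail.simps(2)[of _ _ "Suc k"])
    moreover have "d (Suc (Suc k)) = real (a (Suc (Suc k))) * d (Suc k) + d k"
      by (simp add: d_def algebra_simps)
    moreover note Suc
    ultimately show ?case by algebra
  qed
  have "if even k then 0 < d k else d k < 0"
  proof (induction k)
    case 0
    then show ?case using y[of 0] by (simp add: d_def)
  next
    case (Suc k)
    then show ?case using y[of "Suc k"] unfolding d
      by (auto simp: mult_less_0_iff zero_less_mult_iff simp del: cfrac_tail.simps split: if_splits)
  qed
  then show ?thesis using conv_den_pos[of a k, OF a1]
    by (auto simp: d_def convergent_of_def field_simps split: if_splits)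
qed

section \<open>Growth of the denominators\<close>

text \<open>Confines consecutive denominators to the cone on which
  \<open>quadratic_form_step\<close> holds.\<close>

lemma conv_den_ratio:
  assumes "\<forall>j\<ge>1. 1 \<le> a j \<and> a j \<le> 4"
  shows "conv_den a k \<le> conv_den a (Suc k) \<and> conv_den a (Suc k) \<le> 5 * conv_den a k"
proof (induction k)
  case 0
  then show ?case using assms[rule_format, of 1] by simp
next
  case (Suc k)
  have "1 * conv_den a (Suc k) \<le> a (Suc (Suc k)) * conv_den a (Suc k)"
    "a (Suc (Suc k)) * conv_den a (Suc k) \<le> 4 * conv_den a (Suc k)"
    using assms by (intro mult_right_mono; simp)+
  then show ?case using Suc unfolding conv_den.simps by linarith
qed

text \<open>
  The weights 4 and 3 are tuned to the extremal pattern \<open>[0; 4, 1, 4, 1, \<dots>]\<close>, for which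
  \<open>q\<^sub>t\<^sup>2 / 2\<^bsup>a\<^sub>1 + \<dots> + a\<^sub>t\<^esup>\<close> grows only by the factor \<open>(3 + 2 \<surd>2)\<^sup>2 / 32 \<approx> 1.06\<close> per period.
\<close>

lemma quadratic_form_step:
  fixes u v :: real
  assumes "0 \<le> v" "v \<le> u" "u \<le> 5 * v" "a \<in> {1, 2, 3, 4 :: nat}"
  shows "101 / 100 * 2 ^ a * (4 * u\<^sup>2 + 3 * v * u) \<le> 4 * (real a * u + v)\<^sup>2 + 3 * u * (real a * u + v)"
proof -
  \<comment> \<open>Products of the constraints, from which each case follows linearly in u^2, uv,
    v^2. For a = 1 the difference of the two sides has a negative u^2 coefficient, which
    \<open>u \<le> 5 * v\<close> compensates.\<close>
  have "0 \<le> (u - v) * v" "0 \<le> (5 * v - u) * u" "0 \<le> (5 * v - u) * v" "0 \<le> (u - v) * u" "0 \<le> v * v"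
    "0 \<le> (5 * v - u) * (u - v)" "0 \<le> (u - v) * (u - v)"
    using assms by (auto intro!: mult_nonneg_nonneg)
  then show ?thesis using assms(4)
    by (auto simp: power2_eq_square algebra_simps)
qed

lemma conv_den_growth:
  assumes "\<forall>j\<ge>1. 1 \<le> a j \<and> a j \<le> 4"
  shows "(101 / 100) ^ k * 2 ^ (\<Sum>i=1..Suc k. a i)
    \<le> 4 * (real (conv_den a (Suc k)))\<^sup>2 + 3 * real (conv_den a k) * real (conv_den a (Suc k))"
proof (induction k)
  case 0
  have "a 1 = 1 \<or> a 1 = 2 \<or> a 1 = 3 \<or> a 1 = 4" using assms[rule_format, of 1] by auto
  then show ?case by auto
next
  case (Suc k)
  let ?q = "\<lambda>k. real (conv_den a k)" and ?b = "a (Suc (Suc k))"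
  have r: "?q k \<le> ?q (Suc k)" "?q (Suc k) \<le> 5 * ?q k"
    using conv_den_ratio[OF assms, of k] by linarith+
  have b: "?b \<in> {1, 2, 3, 4}" using assms[rule_format, of "Suc (Suc k)"] by auto
  have "(101 / 100) ^ Suc k * 2 ^ (\<Sum>i=1..Suc (Suc k). a i)
      = 101 / 100 * 2 ^ ?b * ((101 / 100) ^ k * (2::real) ^ (\<Sum>i=1..Suc k. a i))"
    by (simp add: power_add)
  also have "\<dots> \<le> 101 / 100 * 2 ^ ?b * (4 * (?q (Suc k))\<^sup>2 + 3 * ?q k * ?q (Suc k))"
    using Suc by (intro mult_left_mono) auto
  also have "\<dots> \<le> 4 * (real ?b * ?q (Suc k) + ?q k)\<^sup>2 + 3 * ?q (Suc k) * (real ?b * ?q (Suc k) + ?q k)"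
    using r b by (intro quadratic_form_step) auto
  finally show ?case by simp
qed

lemma conv_den_product_growth:
  assumes "\<forall>j\<ge>1. 1 \<le> a j \<and> a j \<le> 4"
  shows "(101 / 100) ^ k / 23 \<le> real (conv_den a k) * real (conv_den a (Suc k)) / 2 ^ (\<Sum>i=1..Suc k. a i)"
proof -
  let ?q = "\<lambda>k. real (conv_den a k)"
  have "?q (Suc k) \<le> 5 * ?q k" using conv_den_ratio[OF assms, of k] by linarith
  then have "?q (Suc k) * ?q (Suc k) \<le> 5 * ?q k * ?q (Suc k)" by (intro mult_right_mono) auto
  \<comment> \<open>Here 23 = 4 * 5 + 3.\<close>
  then have "4 * (?q (Suc k))\<^sup>2 + 3 * ?q k * ?q (Suc k) \<le> 23 * (?q k * ?q (Suc k))"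
    by (simp add: power2_eq_square)
  then have "(101 / 100) ^ k * 2 ^ (\<Sum>i=1..Suc k. a i) \<le> 23 * (?q k * ?q (Suc k))"
    using conv_den_growth[OF assms, of k] by linarith
  then show ?thesis by (simp add: pos_le_divide_eq del: sum.cl_ivl_Suc)
qed

section \<open>The derivative\<close>

text \<open>The assumption on \<open>y\<close> describes the part of J_t outside J_(t+1), with its
  ends included.\<close>

lemma qmark_slope_between_convergents:
  fixes x y :: real
  assumes cf: "has_cfrac x a" "x \<notin> \<rat>" and a: "\<forall>j\<ge>1. 1 \<le> a j \<and> a j \<le> 4"
    and y: "if even t then convergent_of a t \<le> y \<and> y \<le> convergent_of a (Suc (Suc t))
      else convergent_of a (Suc (Suc t)) \<le> y \<and> y \<le> convergent_of a t"
  shows "(101 / 100) ^ t / 5888 \<le> (qmark y - qmark x) / (y - x)"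
proof -
  let ?c = "convergent_of a" and ?w = "conv_qmark a" and ?s = "\<lambda>k. \<Sum>i=1..k. a i"
  let ?t2 = "Suc (Suc t)" and ?t4 = "Suc (Suc (Suc (Suc t)))"
  let ?Q = "real (conv_den a t) * real (conv_den a (Suc t))"
  have a1: "1 \<le> a 1" using a by simp
  note I = convergent_of_point(1)[of a, OF a1]
  note alt = convergent_of_alternates[OF cf]
  have x01: "0 \<le> x" "x \<le> 1"
    using alt[of 0] alt[of 1] I[of 0] I[of 1] by auto
  have Q: "0 < ?Q" using conv_den_pos[of a, OF a1] by simp
  have yx: "\<bar>y - x\<bar> \<le> 1 / ?Q" "y \<noteq> x"
    using alt[of t] alt[of "Suc t"] alt[of ?t2] y convergent_of_diff[of a t, OF a1]
    by (auto split: if_splits)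
  \<comment> \<open>The increment from index t + 2 to t + 4 involves two more partial quotients,
    each at most 4, which costs a factor 2^8 = 256.\<close>
  have "?s (Suc ?t2) = ?s (Suc t) + a ?t2 + a (Suc ?t2)" by simp
  moreover have "a ?t2 \<le> 4" "a (Suc ?t2) \<le> 4" using a by simp_all
  ultimately have "?s (Suc ?t2) \<le> ?s (Suc t) + 8" by linarith
  then have "(2::real) ^ ?s (Suc ?t2) \<le> 2 ^ (?s (Suc t) + 8)" by (intro power_increasing) auto
  then have "1 / (256 * 2 ^ ?s (Suc t)) \<le> 1 / (2::real) ^ ?s (Suc ?t2)"
    by (intro divide_left_mono) (auto simp: power_add)
  also have "\<dots> \<le> \<bar>?w ?t4 - ?w ?t2\<bar>"
    using conv_qmark_diff2_ge[of a ?t2] a by simp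
  finally have w: "1 / (256 * 2 ^ ?s (Suc t)) \<le> \<bar>?w ?t4 - ?w ?t2\<bar>" .
  \<comment> \<open>Here 5888 = 256 * 23.\<close>
  have "(101 / 100) ^ t / 5888 \<le> 1 / (256 * 2 ^ ?s (Suc t)) * ?Q"
    using conv_den_product_growth[OF a, of t] by (simp add: mult.commute)
  also have "\<dots> \<le> \<bar>?w ?t4 - ?w ?t2\<bar> * ?Q" using w Q by (intro mult_right_mono) auto
  also have "\<dots> \<le> \<bar>?w ?t4 - ?w ?t2\<bar> * (1 / \<bar>y - x\<bar>)"
    using yx Q by (intro mult_left_mono) (auto simp: field_simps)
  also have "\<dots> \<le> (qmark y - qmark x) / (y - x)"
    using qmark_slope_ge[of y "?c ?t2" "?c ?t4" x] convergent_of_step2[of a ?t2, OF a1]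
      alt[of ?t4] y x01 I[of t]
    unfolding convergent_of_point(2)[of a, OF a1]
    by (auto simp del: conv_qmark.simps split: if_splits)
  finally show ?thesis .
qed

text \<open>The interior of J_t: strict inequalities make it a neighbourhood of
  \<open>x\<close>.\<close>

definition between_convergents :: "(nat \<Rightarrow> nat) \<Rightarrow> nat \<Rightarrow> real \<Rightarrow> bool" where
  "between_convergents a t y \<longleftrightarrow>
     (if even t then convergent_of a t < y \<and> y < convergent_of a (Suc t)
      else convergent_of a (Suc t) < y \<and> y < convergent_of a t)"

text \<open>J_t has length 1 / (q_t q_(t+1)), and the growth bound, weakened by dropping the power
  of 2, makes this tend to 0.\<close>

lemma between_convergents_leaves:
  assumes a: "\<forall>j\<ge>1. 1 \<le> a j \<and> a j \<le> 4" and cf: "has_cfrac x a" "x \<notin> \<rat>" and "y \<noteq> x"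
  shows "\<exists>t\<ge>T. \<not> between_convergents a t y"
proof (rule ccontr)
  assume "\<not> ?thesis"
  then have b: "between_convergents a t y" if "T \<le> t" for t using that by simp
  have a1: "1 \<le> a 1" using a by simp
  note alt = convergent_of_alternates[OF cf]
  have bound: "(101 / 100) ^ t / 23 * \<bar>y - x\<bar> \<le> 1" if t: "T \<le> t" for t
  proof -
    let ?Q = "real (conv_den a t) * real (conv_den a (Suc t))"
    have Q: "0 < ?Q" using conv_den_pos[of a, OF a1] by simp
    have "\<bar>y - x\<bar> \<le> 1 / ?Q"
      using alt[of t] alt[of "Suc t"] b[OF t] convergent_of_diff[of a t, OF a1]
      by (auto simp: between_convergents_def split: if_splits)
    then have "?Q * \<bar>y - x\<bar> \<le> 1" using Q by (simp add: field_simps)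
    moreover have "(101 / 100) ^ t / 23 \<le> ?Q"
    proof -
      have "?Q / 2 ^ (\<Sum>i=1..Suc t. a i) \<le> ?Q / 1" using Q by (intro divide_left_mono) auto
      then show ?thesis using conv_den_product_growth[OF a, of t] by linarith
    qed
    ultimately show ?thesis by (meson abs_ge_zero mult_right_mono order_trans)
  qed
  obtain t where "23 / \<bar>y - x\<bar> < (101 / 100) ^ t"
    using real_arch_pow[of "101/100" "23 / \<bar>y - x\<bar>"] by auto
  also have "(101 / 100 :: real) ^ t \<le> (101 / 100) ^ (t + T)" by (intro power_increasing) auto
  finally have "1 < (101 / 100) ^ (t + T) / 23 * \<bar>y - x\<bar>" using \<open>y \<noteq> x\<close> by (simp add: field_simps)
  then show False using bound[of "t + T"] by simp
qed

theorem theorem3: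
  fixes x :: real and a :: "nat \<Rightarrow> nat"
  assumes "0 < x" and "x < 1" and "x \<notin> \<rat>"
    and "has_cfrac x a"
    and "\<forall>j\<ge>1. a j \<le> 4"
  shows "has_infinite_derivative qmark x"
proof -
  have a: "\<forall>j\<ge>1. 1 \<le> a j \<and> a j \<le> 4" using assms(4,5) by (simp add: has_cfrac_def)
  have "eventually (\<lambda>\<delta>. M \<le> (qmark (x + \<delta>) - qmark x) / \<delta>) (at 0)" for M
  proof -
    obtain T where T: "5888 * M < (101 / 100) ^ T"
      using real_arch_pow[of "101/100" "5888 * M"] by auto
    let ?S = "{y. between_convergents a T y}"
    have "open ?S"
      unfolding between_convergents_def by (cases "even T") (auto intro!: open_Collect_conj open_Collect_less)
    moreover have "x \<in> ?S"
      using convergent_of_alternates[OF assms(4,3), of T] convergent_of_alternates[OF assms(4,3), of "Suc T"]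
      by (auto simp: between_convergents_def split: if_splits)
    moreover have "((\<lambda>\<delta>. x + \<delta>) \<longlongrightarrow> x) (at 0)" by (auto intro!: tendsto_eq_intros)
    ultimately have "eventually (\<lambda>\<delta>. x + \<delta> \<in> ?S) (at 0)" by (rule topological_tendstoD[rotated])
    moreover have "eventually (\<lambda>\<delta>. \<delta> \<noteq> 0) (at (0::real))" by (simp add: eventually_at_filter)
    ultimately show ?thesis
    proof eventually_elim
      case (elim \<delta>)
      let ?P = "\<lambda>t. between_convergents a t (x + \<delta>)"
      \<comment> \<open>The point lies in J_T but not in all later intervals; the first exit after
        \<open>T\<close> gives an index large enough for the bound \<open>M\<close>.\<close>
      have "\<exists>n\<ge>T. ?P n \<and> \<not> ?P (Suc n)"
      proof (rule ccontr)
        assume step: "\<not> ?thesis"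
        obtain t where "T \<le> t" "\<not> ?P t"
          using between_convergents_leaves[OF a assms(4,3), of "x + \<delta>" T] elim(2) by auto
        moreover have "?P t" if "T \<le> t" for t
          using that by (induction t rule: dec_induct) (use elim(1) step in auto)
        ultimately show False by blast
      qed
      then obtain n where n: "T \<le> n" "?P n" "\<not> ?P (Suc n)" by blast
      \<comment> \<open>J_n and J_(n+1) share the end of index n + 1, so a point of the first
        outside the second lies between the convergents n and n + 2.\<close>
      have "(101 / 100) ^ n / 5888 \<le> (qmark (x + \<delta>) - qmark x) / (x + \<delta> - x)"
        using n(2,3) by (intro qmark_slope_between_convergents[OF assms(4,3) a])
          (auto simp: between_convergents_def)
      moreover have "(101 / 100 :: real) ^ T \<le> (101 / 100) ^ n" using n(1) by (intro power_increasing) auto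
      ultimately have "M \<le> (qmark (x + \<delta>) - qmark x) / (x + \<delta> - x)" using T by linarith
      then show ?case by simp
    qed
  qed
  then show ?thesis unfolding has_infinite_derivative_def filterlim_at_top by blast
qed

end
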